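(* Let $\mathcal{T}$ be a spherically symmetric rooted tree and let $G$ be a saturated weakly branch group on $\mathcal{T}$. Suppose that for every $j$ the level stabilizer $\operatorname{St}_j$ contains an element $g_j$ which defines an odd permutation of the vertices of some level $L_{j_0}$ with $j_0>j$ (where $j_0$ may depend on $j$). Then $G$ is an $R_\infty$ group.
   Context: A rooted tree $\mathcal{T}$ is spherically symmetric if all vertices of the same level have the same (finite) number of immediate descendants. $L_n$ denotes the $n$-th level of $\mathcal{T}$ and $\mathcal{T}_v$ the subtree with root vertex $v$ consisting of $v$ and all its descendants. Groups act on $\mathcal{T}$ by automorphisms (isometries) of the rooted tree. $\operatorname{St}_j$ is the subgroup of all elements of $G$ fixing every vertex of $L_j$. A group $G$ acting faithfully on $\mathcal{T}$ is a weakly branch group if for every vertex $v$ of $\mathcal{T}$ there exists an element of $G$ which acts nontrivially on $\mathcal{T}_v$ and trivially outside $\mathcal{T}_v$. $G$ is saturated if for every positive integer $n$ there exists a characteristic subgroup $H_n\subset G$ which acts trivially on $L_n$ and acts level transitively (i.e. transitively on each level) on every subtree $\mathcal{T}_v$ with $v\in L_n$. For an automorphism $\phi:G\to G$, the Reidemeister number $R(\phi)$ is the number of equivalence classes of the relation $g\sim hg\phi(h^{-1})$, $g,h\in G$. $G$ is an $R_\infty$ group if $R(\phi)=\infty$ for every automorphism $\phi$ of $G$. *)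

theory Defs
  imports "HOL-Algebra.Group_Action" "HOL-Combinatorics.Combinatorics"
    "HOL-Library.Extended_Nat"
begin

text \<open>
  A rooted tree is given by its vertex set, its root \<open>r\<close> and the relation \<open>E\<close> containing
  \<open>(v, w)\<close> iff \<open>w\<close> is an immediate descendant of \<open>v\<close>.
\<close>

locale rooted_tree =
  fixes V :: "'v set" and r :: 'v and E :: "('v \<times> 'v) set"
  assumes edges: "E \<subseteq> V \<times> V"
    and root_in: "r \<in> V"
    and root_no_parent: "\<And>v. (v, r) \<notin> E"
    and unique_parent: "\<And>w. w \<in> V \<Longrightarrow> w \<noteq> r \<Longrightarrow> \<exists>!v. (v, w) \<in> E"
    and reachable: "\<And>v. v \<in> V \<Longrightarrow> (r, v) \<in> E\<^sup>*"

definition tree_level :: "('v \<times> 'v) set \<Rightarrow> 'v \<Rightarrow> nat \<Rightarrow> 'v set" where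
  "tree_level E v n = (E ^^ n) `` {v}"
  \<comment> \<open>level \<open>n\<close> of the subtree rooted at \<open>v\<close>; \<open>L\<^sub>n\<close> is \<open>tree_level E r n\<close>\<close>

definition subtree :: "('v \<times> 'v) set \<Rightarrow> 'v \<Rightarrow> 'v set" where
  "subtree E v = E\<^sup>* `` {v}"

locale spherically_symmetric_tree = rooted_tree V r E
  for V :: "'v set" and r :: 'v and E :: "('v \<times> 'v) set" +
  assumes finite_children: "\<And>v. v \<in> V \<Longrightarrow> finite (E `` {v})"
    and same_number_of_children: "\<And>n v w. v \<in> tree_level E r n \<Longrightarrow> w \<in> tree_level E r n
           \<Longrightarrow> card (E `` {v}) = card (E `` {w})"

definition tree_automorphism :: "'v set \<Rightarrow> 'v \<Rightarrow> ('v \<times> 'v) set \<Rightarrow> ('v \<Rightarrow> 'v) \<Rightarrow> bool" where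
  "tree_automorphism V r E f \<longleftrightarrow>
     bij_betw f V V \<and> f r = r \<and>
     (\<forall>v\<in>V. \<forall>w\<in>V. (f v, f w) \<in> E \<longleftrightarrow> (v, w) \<in> E)"

locale faithful_tree_action =
  rooted_tree V r E + group G + faithful_action G V a
  for V :: "'v set" and r :: 'v and E :: "('v \<times> 'v) set"
    and G :: "('g, 'm) monoid_scheme" (structure) and a :: "'g \<Rightarrow> 'v \<Rightarrow> 'v" +
  assumes acts_by_automorphisms: "\<And>g. g \<in> carrier G \<Longrightarrow> tree_automorphism V r E (a g)"

definition level_stabilizer ::
  "('g, 'm) monoid_scheme \<Rightarrow> 'v \<Rightarrow> ('v \<times> 'v) set \<Rightarrow> ('g \<Rightarrow> 'v \<Rightarrow> 'v) \<Rightarrow> nat \<Rightarrow> 'g set" where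
  "level_stabilizer G r E a j = {g \<in> carrier G. \<forall>v\<in>tree_level E r j. a g v = v}"

definition odd_on_level ::
  "'v \<Rightarrow> ('v \<times> 'v) set \<Rightarrow> ('g \<Rightarrow> 'v \<Rightarrow> 'v) \<Rightarrow> 'g \<Rightarrow> nat \<Rightarrow> bool" where
  "odd_on_level r E a g n \<longleftrightarrow> \<not> evenperm (perm_restrict (a g) (tree_level E r n))"
  \<comment> \<open>\<^const>\<open>evenperm\<close> only counts for permutations moving finitely many points; the levels of
      a spherically symmetric tree are finite\<close>

definition weakly_branch ::
  "'v set \<Rightarrow> 'v \<Rightarrow> ('v \<times> 'v) set \<Rightarrow> ('g, 'm) monoid_scheme \<Rightarrow> ('g \<Rightarrow> 'v \<Rightarrow> 'v) \<Rightarrow> bool" where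
  "weakly_branch V r E G a \<longleftrightarrow>
     faithful_tree_action V r E G a \<and>
     (\<forall>v\<in>V. \<exists>g\<in>carrier G. (\<exists>w\<in>subtree E v. a g w \<noteq> w) \<and> (\<forall>w\<in>V - subtree E v. a g w = w))"

definition characteristic_subgroup :: "'g set \<Rightarrow> ('g, 'm) monoid_scheme \<Rightarrow> bool" where
  "characteristic_subgroup H G \<longleftrightarrow> subgroup H G \<and> (\<forall>\<phi>\<in>iso G G. \<phi> ` H = H)"

definition level_transitive_on_subtree ::
  "('v \<times> 'v) set \<Rightarrow> ('g \<Rightarrow> 'v \<Rightarrow> 'v) \<Rightarrow> 'g set \<Rightarrow> 'v \<Rightarrow> bool" where
  "level_transitive_on_subtree E a H v \<longleftrightarrow>
     (\<forall>k. \<forall>u\<in>tree_level E v k. \<forall>w\<in>tree_level E v k. \<exists>h\<in>H. a h u = w)"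

definition saturated ::
  "'v \<Rightarrow> ('v \<times> 'v) set \<Rightarrow> ('g, 'm) monoid_scheme \<Rightarrow> ('g \<Rightarrow> 'v \<Rightarrow> 'v) \<Rightarrow> bool" where
  "saturated r E G a \<longleftrightarrow>
     (\<forall>n\<ge>1. \<exists>H. characteristic_subgroup H G \<and>
        (\<forall>h\<in>H. \<forall>v\<in>tree_level E r n. a h v = v) \<and>
        (\<forall>v\<in>tree_level E r n. level_transitive_on_subtree E a H v))"

definition twisted_conjugacy ::
  "('g, 'm) monoid_scheme \<Rightarrow> ('g \<Rightarrow> 'g) \<Rightarrow> ('g \<times> 'g) set" where
  "twisted_conjugacy G \<phi> =
     {(g, g'). g \<in> carrier G \<and> g' \<in> carrier G \<and>
        (\<exists>h\<in>carrier G. g' = h \<otimes>\<^bsub>G\<^esub> g \<otimes>\<^bsub>G\<^esub> \<phi> (inv\<^bsub>G\<^esub> h))}"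

definition reidemeister_number :: "('g, 'm) monoid_scheme \<Rightarrow> ('g \<Rightarrow> 'g) \<Rightarrow> enat" where
  "reidemeister_number G \<phi> =
     (let C = carrier G // twisted_conjugacy G \<phi> in if finite C then enat (card C) else \<infinity>)"

definition R_infinity_group :: "('g, 'm) monoid_scheme \<Rightarrow> bool" where
  "R_infinity_group G \<longleftrightarrow> group G \<and> (\<forall>\<phi>\<in>iso G G. reidemeister_number G \<phi> = \<infinity>)"

lemma equiv_twisted_conjugacy:
  assumes "group G" "\<phi> \<in> iso G G"
  shows "equiv (carrier G) (twisted_conjugacy G \<phi>)"
proof -
  interpret group G by fact
  interpret h: group_hom G G \<phi>
    using assms by (simp add: group_hom_def group_hom_axioms_def iso_def)
  show ?thesis
  proof (rule equivI)
    show "twisted_conjugacy G \<phi> \<subseteq> carrier G \<times> carrier G"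
      by (auto simp: twisted_conjugacy_def)
    show "refl_on (carrier G) (twisted_conjugacy G \<phi>)"
      by (auto simp: refl_on_def twisted_conjugacy_def intro!: bexI[of _ "\<one>\<^bsub>G\<^esub>"])
    show "sym (twisted_conjugacy G \<phi>)"
    proof (rule symI)
      fix x y assume "(x, y) \<in> twisted_conjugacy G \<phi>"
      then obtain k where k: "x \<in> carrier G" "y \<in> carrier G" "k \<in> carrier G"
          "y = k \<otimes>\<^bsub>G\<^esub> x \<otimes>\<^bsub>G\<^esub> \<phi> (inv\<^bsub>G\<^esub> k)"
        by (auto simp: twisted_conjugacy_def)
      have "\<phi> (inv\<^bsub>G\<^esub> k) \<otimes>\<^bsub>G\<^esub> \<phi> k = \<one>\<^bsub>G\<^esub>"
        using k(3) by (simp flip: h.hom_mult)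
      with k have "x = inv\<^bsub>G\<^esub> k \<otimes>\<^bsub>G\<^esub> y \<otimes>\<^bsub>G\<^esub> \<phi> (inv\<^bsub>G\<^esub> (inv\<^bsub>G\<^esub> k))"
        by (simp add: m_assoc del: h.hom_inv) (simp flip: m_assoc)
      with k(1-2) inv_closed[OF k(3)] show "(y, x) \<in> twisted_conjugacy G \<phi>"
        unfolding twisted_conjugacy_def by blast
    qed
    show "trans (twisted_conjugacy G \<phi>)"
    proof (rule transI)
      fix x y z assume "(x, y) \<in> twisted_conjugacy G \<phi>" "(y, z) \<in> twisted_conjugacy G \<phi>"
      then obtain k l where k: "x \<in> carrier G" "z \<in> carrier G" "k \<in> carrier G" "l \<in> carrier G"
          "z = l \<otimes>\<^bsub>G\<^esub> (k \<otimes>\<^bsub>G\<^esub> x \<otimes>\<^bsub>G\<^esub> \<phi> (inv\<^bsub>G\<^esub> k)) \<otimes>\<^bsub>G\<^esub> \<phi> (inv\<^bsub>G\<^esub> l)"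
        by (auto simp: twisted_conjugacy_def)
      then have "z = (l \<otimes>\<^bsub>G\<^esub> k) \<otimes>\<^bsub>G\<^esub> x \<otimes>\<^bsub>G\<^esub> \<phi> (inv\<^bsub>G\<^esub> (l \<otimes>\<^bsub>G\<^esub> k))"
        by (simp add: m_assoc inv_mult_group del: h.hom_inv)
      with k(1-2) m_closed[OF k(4,3)] show "(x, z) \<in> twisted_conjugacy G \<phi>"
        unfolding twisted_conjugacy_def by blast
    qed
  qed
qed

end

theory Submission
  imports Defs
begin

text \<open>
  The parity of the permutation that an element induces on a level turns out to be an invariant of
  twisted conjugacy. The relation \<open>y = h x \<phi>(h\<^sup>-\<^sup>1)\<close> changes the sign on level \<open>n\<close> by
  \<open>sgn(h) sgn(\<phi>(h\<^sup>-\<^sup>1))\<close>, which is trivial as soon as \<open>\<phi>\<close> preserves signs. So all elements of a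
  twisted conjugacy class have the same set of levels on which they are odd, and in particular the
  same first odd level. Since the level stabilizers contain elements that are odd somewhere, the first
  odd level takes arbitrarily large values, and there are infinitely many classes.

  What has to be shown is that an automorphism \<open>\<phi>\<close> preserves signs on every level \<open>n \<ge> 1\<close>. For this
  it suffices to find a permutation \<open>t\<close> of \<open>L\<^sub>n\<close> such that \<open>t (g v) = \<phi>(g) (t v)\<close>
  (\<open>iso_induced_on_level\<close>); then \<open>g\<close> and \<open>\<phi>(g)\<close> induce conjugate permutations of \<open>L\<^sub>n\<close>. It is a
  one-level version of the theorem that automorphisms of saturated weakly branch groups are induced
  by automorphisms of the tree, and it comes from recovering the \<open>G\<close>-set \<open>L\<^sub>n\<close> from the group
  structure. Let \<open>H\<close> be the characteristic subgroup that saturation provides for level \<open>n\<close>, and let the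
  support of \<open>x \<in> H\<close> be the set of those \<open>v \<in> L\<^sub>n\<close> for which \<open>x\<close> acts nontrivially on the subtree
  below \<open>v\<close>. The key fact (\<open>commutes_with_conjugates_iff\<close>) is that \<open>x\<close> commutes with all
  \<open>H\<close>-conjugates of \<open>y\<close> exactly if the supports of \<open>x\<close> and \<open>y\<close> are disjoint. The first condition is
  purely algebraic, so \<open>\<phi>\<close> preserves disjointness of supports. As every vertex of \<open>L\<^sub>n\<close> is the support
  of some element of \<open>H\<close>, it follows that \<open>\<phi>\<close> maps elements supported at one vertex to elements
  supported at one vertex, and this defines \<open>t\<close>.
\<close>

section \<open>Conjugation\<close>

definition conj_by :: "('g, 'm) monoid_scheme \<Rightarrow> 'g \<Rightarrow> 'g \<Rightarrow> 'g" where
  "conj_by G g x = g \<otimes>\<^bsub>G\<^esub> x \<otimes>\<^bsub>G\<^esub> inv\<^bsub>G\<^esub> g"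

text \<open>
  Equivalently, the normal closures of \<open>x\<close> and \<open>y\<close> in \<open>H\<close> commute. The formulation with elements
  makes it immediate that automorphisms respect the relation.
\<close>

definition commutes_with_conjugates ::
  "('g, 'm) monoid_scheme \<Rightarrow> 'g set \<Rightarrow> 'g \<Rightarrow> 'g \<Rightarrow> bool" where
  "commutes_with_conjugates G H x y \<longleftrightarrow> (\<forall>h\<in>H. conj_by G x (conj_by G h y) = conj_by G h y)"

context group
begin

lemma conj_by_closed [simp]:
  "g \<in> carrier G \<Longrightarrow> x \<in> carrier G \<Longrightarrow> conj_by G g x \<in> carrier G"
  by (simp add: conj_by_def)

lemma conj_by_cancel: "g \<in> carrier G \<Longrightarrow> x \<in> carrier G \<Longrightarrow> conj_by G g x \<otimes> g = g \<otimes> x"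
  by (simp add: conj_by_def m_assoc)

lemma conj_by_eq_iff:
  assumes "g \<in> carrier G" "x \<in> carrier G"
  shows "conj_by G g x = x \<longleftrightarrow> g \<otimes> x = x \<otimes> g"
  using assms by (metis conj_by_def conj_by_cancel inv_solve_right m_closed)

lemma conj_by_mult:
  "g \<in> carrier G \<Longrightarrow> x \<in> carrier G \<Longrightarrow> y \<in> carrier G \<Longrightarrow>
   conj_by G g (x \<otimes> y) = conj_by G g x \<otimes> conj_by G g y"
  by (simp add: conj_by_def m_assoc inv_solve_left)

lemma conj_by_inv:
  "g \<in> carrier G \<Longrightarrow> x \<in> carrier G \<Longrightarrow> conj_by G g (inv x) = inv (conj_by G g x)"
  by (simp add: conj_by_def m_assoc inv_mult_group)

lemma conj_by_conj_by:
  "g \<in> carrier G \<Longrightarrow> h \<in> carrier G \<Longrightarrow> x \<in> carrier G \<Longrightarrow>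
   conj_by G g (conj_by G h x) = conj_by G (g \<otimes> h) x"
  by (simp add: conj_by_def m_assoc inv_mult_group)

lemma conj_by_one [simp]: "x \<in> carrier G \<Longrightarrow> conj_by G \<one> x = x"
  by (simp add: conj_by_def)

lemma conj_by_iso:
  assumes "g \<in> carrier G"
  shows "conj_by G g \<in> iso G G"
proof -
  have inv: "conj_by G g (conj_by G (inv g) x) = x" "conj_by G (inv g) (conj_by G g x) = x"
    if "x \<in> carrier G" for x
    using that assms by (simp_all add: conj_by_conj_by)
  have "bij_betw (conj_by G g) (carrier G) (carrier G)"
    by (rule bij_betw_byWitness[where f' = "conj_by G (inv g)"]) (use assms inv in auto)
  then show ?thesis
    using assms by (auto simp: iso_def hom_def conj_by_mult)
qed

lemma iso_conj_by:
  assumes "\<phi> \<in> iso G G" "g \<in> carrier G" "x \<in> carrier G"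
  shows "\<phi> (conj_by G g x) = conj_by G (\<phi> g) (\<phi> x)"
proof -
  interpret h: group_hom G G \<phi>
    using assms is_group by (simp add: group_hom_def group_hom_axioms_def iso_def)
  show ?thesis
    using assms by (simp add: conj_by_def)
qed

lemma iso_commutes_with_conjugates:
  assumes \<phi>: "\<phi> \<in> iso G G" "\<phi> ` H = H" and H: "H \<subseteq> carrier G" and xy: "x \<in> H" "y \<in> H"
  shows "commutes_with_conjugates G H (\<phi> x) (\<phi> y) \<longleftrightarrow> commutes_with_conjugates G H x y"
proof -
  have inj: "inj_on \<phi> (carrier G)"
    using \<phi>(1) by (simp add: iso_def bij_betw_def)
  have "conj_by G (\<phi> x) (conj_by G (\<phi> h) (\<phi> y)) = conj_by G (\<phi> h) (\<phi> y) \<longleftrightarrow>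
      conj_by G x (conj_by G h y) = conj_by G h y" if "h \<in> H" for h
  proof -
    have "h \<in> carrier G" "x \<in> carrier G" "y \<in> carrier G"
      using that H xy by auto
    then show ?thesis
      using inj by (simp add: inj_on_eq_iff flip: iso_conj_by[OF \<phi>(1)])
  qed
  then have "commutes_with_conjugates G (\<phi> ` H) (\<phi> x) (\<phi> y) \<longleftrightarrow> commutes_with_conjugates G H x y"
    by (simp add: commutes_with_conjugates_def)
  then show ?thesis
    by (simp add: \<phi>(2))
qed

end


section \<open>Levels and subtrees\<close>

lemma mem_subtree_iff: "z \<in> subtree E v \<longleftrightarrow> (\<exists>k. z \<in> tree_level E v k)"
  by (auto simp: subtree_def tree_level_def rtrancl_is_UN_relpow)

lemma subtree_refl [simp]: "v \<in> subtree E v"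
  by (simp add: subtree_def)

lemma subtree_trans: "w \<in> subtree E v \<Longrightarrow> z \<in> subtree E w \<Longrightarrow> z \<in> subtree E v"
  by (auto simp: subtree_def)

lemma tree_level_add: "w \<in> tree_level E v m \<Longrightarrow> z \<in> tree_level E w k \<Longrightarrow> z \<in> tree_level E v (m + k)"
  by (auto simp: tree_level_def relpow_add)

lemma tree_level_split: "z \<in> tree_level E v (m + k) \<Longrightarrow> \<exists>w\<in>tree_level E v m. z \<in> tree_level E w k"
  by (auto simp: tree_level_def relpow_add)

context rooted_tree
begin

lemma tree_level_in_V:
  assumes "v \<in> V" "w \<in> tree_level E v k"
  shows "w \<in> V"
proof -
  have "(v, w) \<in> E ^^ k \<Longrightarrow> w \<in> V" for w
    using \<open>v \<in> V\<close> edges by (cases k) auto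
  then show ?thesis
    using assms(2) by (simp add: tree_level_def)
qed

lemma subtree_in_V: "v \<in> V \<Longrightarrow> w \<in> subtree E v \<Longrightarrow> w \<in> V"
  by (auto simp: mem_subtree_iff intro: tree_level_in_V)

lemma level_exists: "v \<in> V \<Longrightarrow> \<exists>n. v \<in> tree_level E r n"
  using reachable by (auto simp: tree_level_def rtrancl_is_UN_relpow)

lemma parent_unique: "(u, w) \<in> E \<Longrightarrow> (v, w) \<in> E \<Longrightarrow> u = v"
  using edges root_no_parent unique_parent by (metis SigmaD2 subsetD)

lemma ancestor_unique: "z \<in> tree_level E u k \<Longrightarrow> z \<in> tree_level E v k \<Longrightarrow> u = v"
  using relpow_left_unique[of E u z k v] parent_unique by (auto simp: tree_level_def)

lemma level_unique:
  assumes "z \<in> tree_level E r p" "z \<in> tree_level E r q"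
  shows "p = q"
  using assms
proof (induction p arbitrary: q z)
  case 0
  then show ?case
    using root_no_parent by (cases q) (auto simp: tree_level_def)
next
  case (Suc p)
  from Suc.prems(1) obtain y where y: "y \<in> tree_level E r p" "(y, z) \<in> E"
    by (auto simp: tree_level_def)
  with Suc.prems(2) obtain q' where q: "q = Suc q'"
    using root_no_parent by (cases q) (auto simp: tree_level_def)
  with Suc.prems(2) obtain y' where "y' \<in> tree_level E r q'" "(y', z) \<in> E"
    by (auto simp: tree_level_def)
  with y q Suc.IH show ?case
    using parent_unique by metis
qed

lemma subtree_same_level:
  assumes "u \<in> tree_level E r m" "v \<in> tree_level E r m"
    and "z \<in> subtree E u" "z \<in> subtree E v"
  shows "u = v"
proof -
  obtain k l where kl: "z \<in> tree_level E u k" "z \<in> tree_level E v l"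
    using assms by (auto simp: mem_subtree_iff)
  then have "m + k = m + l"
    using level_unique[OF tree_level_add[OF assms(1)] tree_level_add[OF assms(2)]] by blast
  with kl show ?thesis
    using ancestor_unique by simp
qed

end

lemma (in spherically_symmetric_tree) finite_level: "finite (tree_level E r n)"
proof (induction n)
  case (Suc n)
  have "tree_level E r (Suc n) = (\<Union>v\<in>tree_level E r n. E `` {v})"
    by (auto simp: tree_level_def)
  then show ?case
    using Suc finite_children tree_level_in_V[OF root_in] by auto
qed (simp add: tree_level_def)


section \<open>Rigid stabilizers\<close>

locale weakly_branch_action = faithful_tree_action V r E G a
  for V :: "'v set" and r :: 'v and E :: "('v \<times> 'v) set"
    and G :: "('g, 'm) monoid_scheme" (structure) and a :: "'g \<Rightarrow> 'v \<Rightarrow> 'v" +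
  assumes rigid: "v \<in> V \<Longrightarrow>
    \<exists>g\<in>carrier G. (\<exists>w\<in>subtree E v. a g w \<noteq> w) \<and> (\<forall>w\<in>V - subtree E v. a g w = w)"
begin

abbreviation L where "L n \<equiv> tree_level E r n"
abbreviation T where "T v \<equiv> subtree E v"

definition rist where "rist u = {g \<in> carrier G. \<forall>z\<in>V - T u. a g z = z}"

lemma act_in_V: "g \<in> carrier G \<Longrightarrow> z \<in> V \<Longrightarrow> a g z \<in> V"
  by (rule element_image) auto

lemma act_eq_iff: "g \<in> carrier G \<Longrightarrow> w \<in> V \<Longrightarrow> z \<in> V \<Longrightarrow> a g w = a g z \<longleftrightarrow> w = z"
  using inj_on_eq_iff[OF inj_prop] by blast

lemma act_inv_act [simp]: "g \<in> carrier G \<Longrightarrow> z \<in> V \<Longrightarrow> a (inv g) (a g z) = z"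
  by (rule orbit_sym_aux) auto

lemma act_act_inv [simp]: "g \<in> carrier G \<Longrightarrow> z \<in> V \<Longrightarrow> a g (a (inv g) z) = z"
  using act_inv_act[of "inv g" z] by simp

lemma act_one [simp]: "z \<in> V \<Longrightarrow> a \<one> z = z"
  using id_eq_one by (metis restrict_apply')

lemma act_conj_by:
  "g \<in> carrier G \<Longrightarrow> x \<in> carrier G \<Longrightarrow> z \<in> V \<Longrightarrow> a (conj_by G g x) (a g z) = a g (a x z)"
  using composition_rule[of z "conj_by G g x" g] composition_rule[of z g x] conj_by_cancel[of g x]
  by simp

lemma eqI_act:
  assumes "g \<in> carrier G" "h \<in> carrier G" "\<And>z. z \<in> V \<Longrightarrow> a g z = a h z"
  shows "g = h"
proof -
  have "a g \<in> extensional V" "a h \<in> extensional V"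
    using assms(1,2) bij_prop0 by (auto simp: Bij_def)
  then have "a g = a h"
    by (rule extensionalityI) (rule assms(3))
  then show ?thesis
    using faithful assms(1,2) by (simp add: inj_on_eq_iff)
qed

lemma moves_some_vertex: "g \<in> carrier G \<Longrightarrow> g \<noteq> \<one> \<Longrightarrow> \<exists>z\<in>V. a g z \<noteq> z"
  using eqI_act[of g \<one>] by auto

lemma act_edge:
  "g \<in> carrier G \<Longrightarrow> (v, w) \<in> E \<Longrightarrow> (a g v, a g w) \<in> E"
  using acts_by_automorphisms edges unfolding tree_automorphism_def by blast

lemma act_tree_level:
  assumes "g \<in> carrier G" "w \<in> tree_level E v k"
  shows "a g w \<in> tree_level E (a g v) k"
proof -
  have "(v, w) \<in> E ^^ k \<Longrightarrow> (a g v, a g w) \<in> E ^^ k"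
    using assms(1) by (induction k arbitrary: w) (auto dest: act_edge)
  then show ?thesis
    using assms(2) by (simp add: tree_level_def)
qed

lemma act_subtree: "g \<in> carrier G \<Longrightarrow> w \<in> T v \<Longrightarrow> a g w \<in> T (a g v)"
  unfolding mem_subtree_iff using act_tree_level by blast

lemma act_root: "g \<in> carrier G \<Longrightarrow> a g r = r"
  using acts_by_automorphisms unfolding tree_automorphism_def by blast

lemma act_level: "g \<in> carrier G \<Longrightarrow> w \<in> L n \<Longrightarrow> a g w \<in> L n"
  using act_tree_level[of g w r n] by (simp add: act_root)

lemma level_in_V: "v \<in> L n \<Longrightarrow> v \<in> V"
  by (rule tree_level_in_V[OF root_in])

text \<open>
  A vertex and its image lie on the same level, so one cannot be below the other.
\<close>

lemma moved_disjoint: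
  assumes "u \<in> V" "x \<in> carrier G" "a x u \<noteq> u"
  shows "T u \<inter> T (a x u) = {}"
proof -
  obtain m where m: "u \<in> L m"
    using level_exists assms(1) by blast
  show ?thesis
    using subtree_same_level[OF m act_level[OF assms(2) m]] assms(3) by auto
qed

lemma moved_descendant:
  assumes "u \<in> V" "x \<in> carrier G" "a x u \<noteq> u" "w \<in> T u"
  shows "a x w \<noteq> w"
proof
  assume "a x w = w"
  then have "w \<in> T u \<inter> T (a x u)"
    using act_subtree[OF assms(2,4)] assms(4) by simp
  then show False
    using moved_disjoint[OF assms(1-3)] by blast
qed

lemma ristD: "g \<in> rist u \<Longrightarrow> g \<in> carrier G" "g \<in> rist u \<Longrightarrow> z \<in> V \<Longrightarrow> z \<notin> T u \<Longrightarrow> a g z = z"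
  by (auto simp: rist_def)

lemma rist_mono:
  assumes "w \<in> T u"
  shows "rist w \<subseteq> rist u"
proof -
  have "V - T u \<subseteq> V - T w"
    using subtree_trans[OF assms] by blast
  then show ?thesis
    unfolding rist_def by blast
qed

lemma rist_mult: "g \<in> rist u \<Longrightarrow> h \<in> rist u \<Longrightarrow> g \<otimes> h \<in> rist u"
  by (auto simp: rist_def composition_rule)

lemma rist_inv: "g \<in> rist u \<Longrightarrow> inv g \<in> rist u"
proof -
  assume g: "g \<in> rist u"
  have "a (inv g) z = z" if "z \<in> V - T u" for z
  proof -
    have "a g z = z" "g \<in> carrier G" "z \<in> V"
      using g that by (auto simp: rist_def)
    then show ?thesis
      using act_inv_act[of g z] by simp
  qed
  then show ?thesis
    using g by (simp add: rist_def)
qed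

lemma rist_moves: "g \<in> rist u \<Longrightarrow> g \<noteq> \<one> \<Longrightarrow> \<exists>z\<in>T u. z \<in> V \<and> a g z \<noteq> z"
  using moves_some_vertex unfolding rist_def by blast

lemma rist_nontrivial: "u \<in> V \<Longrightarrow> \<exists>g\<in>rist u. g \<noteq> \<one>"
proof -
  assume u: "u \<in> V"
  obtain g w where g: "g \<in> carrier G" "w \<in> T u" "a g w \<noteq> w" "\<forall>w\<in>V - T u. a g w = w"
    using rigid[OF u] by blast
  have "g \<noteq> \<one>"
    using g(3) act_one subtree_in_V[OF u g(2)] by auto
  then show ?thesis
    using g by (auto simp: rist_def)
qed

lemma rist_subtree:
  assumes "g \<in> rist u" "u \<in> V" "z \<in> T u"
  shows "a g z \<in> T u"
proof (rule ccontr)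
  assume *: "a g z \<notin> T u"
  have z: "z \<in> V" "g \<in> carrier G"
    using assms subtree_in_V ristD(1) by blast+
  then have "a g (a g z) = a g z"
    using assms(1) * act_in_V ristD(2) by blast
  then have "a g z = z"
    using act_eq_iff z act_in_V by blast
  then show False
    using * assms(3) by simp
qed

lemma conj_by_rist:
  assumes g: "g \<in> rist u" and h: "h \<in> carrier G" and u: "u \<in> V"
  shows "conj_by G h g \<in> rist (a h u)"
proof -
  have "a (conj_by G h g) z = z" if z: "z \<in> V" "z \<notin> T (a h u)" for z
  proof -
    define y where "y = a (inv h) z"
    have y: "y \<in> V" "a h y = z"
      using h z act_in_V by (auto simp: y_def)
    then have "y \<notin> T u"
      using act_subtree h z by blast
    then show ?thesis
      using act_conj_by[OF h ristD(1)[OF g] y(1)] ristD(2)[OF g y(1)] y(2) by simp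
  qed
  then show ?thesis
    using g h by (auto simp: rist_def)
qed

lemma disjoint_rist:
  assumes "T u \<inter> T v = {}" "g \<in> rist u" "g \<in> rist v"
  shows "g = \<one>"
  using rist_moves[of g u] assms ristD(2)[of g v] by blast

lemma disjoint_rist_commute:
  assumes uv: "u \<in> V" "v \<in> V" "T u \<inter> T v = {}" and g: "g \<in> rist u" and h: "h \<in> rist v"
  shows "g \<otimes> h = h \<otimes> g"
proof (rule eqI_act)
  fix z assume z: "z \<in> V"
  have gh: "g \<in> carrier G" "h \<in> carrier G"
    using g h ristD(1) by blast+
  have "a g (a h z) = a h (a g z)"
  proof (cases "z \<in> T u")
    case True
    then have "a h (a g z) = a g z"
      using rist_subtree[OF g uv(1)] uv(3) ristD(2)[OF h] z act_in_V[OF gh(1)] by blast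
    moreover have "a h z = z"
      using True uv(3) ristD(2)[OF h z] by blast
    ultimately show ?thesis by simp
  next
    case False
    then have gz: "a g z = z"
      using ristD(2)[OF g z] by blast
    show ?thesis
    proof (cases "z \<in> T v")
      case True
      then have "a g (a h z) = a h z"
        using rist_subtree[OF h uv(2)] uv(3) ristD(2)[OF g] z act_in_V[OF gh(2)] by blast
      with gz show ?thesis by simp
    next
      case False
      then show ?thesis
        using gz ristD(2)[OF h z] by simp
    qed
  qed
  then show "a (g \<otimes> h) z = a (h \<otimes> g) z"
    using z gh by (simp add: composition_rule)
qed (use g h ristD(1) in blast)+

text \<open>
  Conjugation by \<open>x\<close> carries the rigid stabilizer of \<open>u\<close> to that of \<open>x u\<close>. If \<open>x\<close> moves \<open>u\<close>, these
  two live on disjoint subtrees. All noncommutativity used below comes from this observation.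
\<close>

lemma conj_by_moved_rist:
  assumes "g \<in> rist u" "u \<in> V" "x \<in> carrier G" "a x u \<noteq> u" "conj_by G x g = g"
  shows "g = \<one>"
  using disjoint_rist[OF moved_disjoint[OF assms(2-4)] assms(1)] conj_by_rist[OF assms(1,3,2)] assms(5)
  by simp

text \<open>
  Below a leaf an element could act nontrivially only by moving the leaf itself, but an element of its
  rigid stabilizer maps the one-vertex subtree into itself.
\<close>

lemma no_leaf:
  assumes "v \<in> V"
  shows "\<exists>w. (v, w) \<in> E"
proof (rule ccontr)
  assume "\<not> ?thesis"
  then have Tv: "T v = {v}"
    by (auto simp: subtree_def elim: converse_rtranclE)
  obtain g where g: "g \<in> rist v" "g \<noteq> \<one>"
    using rist_nontrivial assms by blast
  then show False
    using rist_moves[OF g] rist_subtree[OF g(1) assms] Tv by auto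
qed

lemma tree_level_nonempty: "v \<in> V \<Longrightarrow> \<exists>w. w \<in> tree_level E v k"
proof (induction k)
  case (Suc k)
  then obtain w where w: "w \<in> tree_level E v k"
    by blast
  then obtain w' where "(w, w') \<in> E"
    using no_leaf tree_level_in_V Suc.prems by blast
  with w show ?case
    by (auto simp: tree_level_def)
qed (simp add: tree_level_def)

text \<open>
  A moved vertex drags all its descendants along, and it has some on every lower level.
\<close>

lemma fixes_upper_levels:
  assumes g: "g \<in> carrier G" "\<And>v. v \<in> L n \<Longrightarrow> a g v = v" and "m \<le> n" "w \<in> L m"
  shows "a g w = w"
proof (rule ccontr)
  assume *: "a g w \<noteq> w"
  obtain z where z: "z \<in> tree_level E w (n - m)"
    using tree_level_nonempty[OF level_in_V[OF assms(4)]] by blast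
  then have "z \<in> L n"
    using tree_level_add[OF assms(4) z] assms(3) by simp
  moreover have "a g z \<noteq> z"
    using moved_descendant[OF level_in_V[OF assms(4)] g(1) *] z by (auto simp: mem_subtree_iff)
  ultimately show False
    using g(2) by blast
qed

end


section \<open>Supports in a saturating subgroup\<close>

text \<open>
  Of the invariance of a characteristic subgroup only normality is built in. It carries the geometric
  arguments about supports; invariance under a single automorphism \<open>\<phi>\<close> is a hypothesis of the lemmas
  that compare supports of \<open>x\<close> and \<open>\<phi>(x)\<close>.
\<close>

locale saturating_subgroup = weakly_branch_action V r E G a
  for V :: "'v set" and r :: 'v and E :: "('v \<times> 'v) set"
    and G :: "('g, 'm) monoid_scheme" (structure) and a :: "'g \<Rightarrow> 'v \<Rightarrow> 'v" +
  fixes n :: nat and H :: "'g set"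
  assumes sub: "subgroup H G"
    and conj_closed: "g \<in> carrier G \<Longrightarrow> h \<in> H \<Longrightarrow> conj_by G g h \<in> H"
    and fixes_level: "h \<in> H \<Longrightarrow> v \<in> L n \<Longrightarrow> a h v = v"
    and level_transitive: "v \<in> L n \<Longrightarrow> level_transitive_on_subtree E a H v"
begin

definition supp where "supp x = {v \<in> L n. \<exists>z\<in>T v. a x z \<noteq> z}"

lemma H_carrier: "h \<in> H \<Longrightarrow> h \<in> carrier G"
  using subgroup.subset[OF sub] by blast

lemma H_transitive:
  assumes "v \<in> L n" "u \<in> tree_level E v k" "w \<in> tree_level E v k"
  obtains h where "h \<in> H" "a h u = w"
  using level_transitive[OF assms(1)] assms(2,3) that
  unfolding level_transitive_on_subtree_def by blast

text \<open>
  An element of the rigid stabilizer need not lie in \<open>H\<close>, but commutators with elements of \<open>H\<close> do.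
  Take \<open>g\<close> in the rigid stabilizer of \<open>w\<close> moving \<open>u\<close>, choose \<open>h \<in> H\<close> that moves \<open>u\<close> to the same place
  as \<open>g\<close> does, and \<open>x \<noteq> \<one>\<close> in the rigid stabilizer of \<open>u\<close>. The commutator of \<open>x\<close> and \<open>h\<close> acts
  nontrivially, and only below \<open>u\<close> and \<open>g u\<close>, both of which are descendants of \<open>w\<close>.
\<close>

lemma H_rist_nontrivial:
  assumes v: "v \<in> L n" and w: "w \<in> T v"
  shows "\<exists>g\<in>H \<inter> rist w. g \<noteq> \<one>"
proof -
  have V: "v \<in> V" "w \<in> V"
    using v w level_in_V subtree_in_V by blast+
  obtain g where g: "g \<in> rist w" "g \<noteq> \<one>"
    using rist_nontrivial V by blast
  then obtain u where u: "u \<in> T w" "u \<in> V" "a g u \<noteq> u"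
    using rist_moves by blast
  have u': "a g u \<in> T w"
    using rist_subtree g V u by blast
  obtain k where k: "u \<in> tree_level E v k"
    using subtree_trans[OF w u(1)] by (auto simp: mem_subtree_iff)
  have gv: "a g v = v"
  proof (rule subtree_same_level)
    show "a g v \<in> L n" "v \<in> L n"
      using act_level[OF ristD(1)[OF g(1)] v] v by simp_all
    show "a g u \<in> T (a g v)"
      by (rule act_subtree[OF ristD(1)[OF g(1)] subtree_trans[OF w u(1)]])
    show "a g u \<in> T v"
      by (rule subtree_trans[OF w u'])
  qed
  then have "a g u \<in> tree_level E v k"
    using act_tree_level[OF ristD(1)[OF g(1)] k] by simp
  then obtain h where h: "h \<in> H" "a h u = a g u"
    using H_transitive[OF v k] by blast
  obtain x where x: "x \<in> rist u" "x \<noteq> \<one>"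
    using rist_nontrivial u by blast
  have car: "h \<in> carrier G" "x \<in> carrier G"
    using H_carrier[OF h(1)] ristD(1)[OF x(1)] .
  \<comment> \<open>the first form of the commutator shows that it is in \<open>H\<close>, the second one where it acts\<close>
  define c where "c = conj_by G x h \<otimes> inv h"
  have c_alt: "c = x \<otimes> inv (conj_by G h x)"
    using car by (simp add: c_def conj_by_def m_assoc inv_mult_group)
  have "c \<in> H"
    using conj_closed car h(1) subgroup.m_closed[OF sub] subgroup.m_inv_closed[OF sub]
    by (simp add: c_def)
  moreover have "conj_by G h x \<in> rist w"
    using conj_by_rist[OF x(1) car(1) u(2)] h(2) u' rist_mono by auto
  then have "c \<in> rist w"
    using x(1) rist_mono[OF u(1)] by (auto simp: c_alt intro!: rist_mult rist_inv)
  moreover have "c \<noteq> \<one>"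
  proof
    assume "c = \<one>"
    then have "conj_by G h x = x"
      using inv_solve_right[of \<one> x "conj_by G h x"] car by (simp add: c_alt)
    then show False
      using conj_by_moved_rist[OF x(1) u(2) car(1)] h(2) u(3) x(2) by simp
  qed
  ultimately show ?thesis
    by blast
qed

text \<open>
  If \<open>k\<close> moves \<open>u\<close>, it cannot commute with a nontrivial element that acts only below \<open>u\<close>.
\<close>

lemma H_rist_nonabelian:
  assumes v: "v \<in> L n" and w: "w \<in> T v"
  shows "\<exists>g\<in>H \<inter> rist w. \<exists>k\<in>H \<inter> rist w. conj_by G k g \<noteq> g"
proof -
  have V: "v \<in> V" "w \<in> V"
    using v w level_in_V subtree_in_V by blast+
  obtain k where k: "k \<in> H" "k \<in> rist w" "k \<noteq> \<one>"
    using H_rist_nontrivial[OF v w] by blast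
  then obtain u where u: "u \<in> T w" "u \<in> V" "a k u \<noteq> u"
    using rist_moves by blast
  obtain g where g: "g \<in> H" "g \<in> rist u" "g \<noteq> \<one>"
    using H_rist_nontrivial[OF v subtree_trans[OF w u(1)]] by blast
  have "conj_by G k g \<noteq> g"
    using conj_by_moved_rist[OF g(2) u(2) H_carrier[OF k(1)] u(3)] g(3) by blast
  then show ?thesis
    using g k rist_mono[OF u(1)] by blast
qed

lemma supp_singleton_exists:
  assumes "v \<in> L n"
  shows "\<exists>x\<in>H. supp x = {v}"
proof -
  obtain x where x: "x \<in> H" "x \<in> rist v" "x \<noteq> \<one>"
    using H_rist_nontrivial[OF assms subtree_refl] by blast
  have "u = v" if "u \<in> supp x" for u
  proof -
    from that obtain z where z: "u \<in> L n" "z \<in> T u" "a x z \<noteq> z"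
      unfolding supp_def by blast
    then have "z \<in> T v"
      using ristD(2)[OF x(2) subtree_in_V[OF level_in_V]] by blast
    with z assms show ?thesis
      using subtree_same_level by blast
  qed
  moreover have "v \<in> supp x"
    using rist_moves[OF x(2,3)] assms by (auto simp: supp_def)
  ultimately show ?thesis
    using x(1) by blast
qed

lemma supp_conj_by:
  assumes g: "g \<in> carrier G" and x: "x \<in> carrier G"
  shows "supp (conj_by G g x) = a g ` supp x"
proof -
  have sub: "a g ` supp x \<subseteq> supp (conj_by G g x)"
    if "g \<in> carrier G" "x \<in> carrier G" for g x
  proof
    fix w assume "w \<in> a g ` supp x"
    then obtain v z where v: "w = a g v" "v \<in> L n" "z \<in> T v" "a x z \<noteq> z"
      by (auto simp: supp_def)
    then have z: "z \<in> V"
      using level_in_V subtree_in_V by blast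
    have "a (conj_by G g x) (a g z) \<noteq> a g z"
      using act_conj_by[OF that z] act_eq_iff[OF that(1) act_in_V[OF that(2) z] z] v(4) by simp
    then show "w \<in> supp (conj_by G g x)"
      unfolding supp_def v(1) using act_level[OF that(1) v(2)] act_subtree[OF that(1) v(3)] by blast
  qed
  have "w \<in> a g ` supp x" if w: "w \<in> supp (conj_by G g x)" for w
  proof -
    have "a (inv g) w \<in> supp (conj_by G (inv g) (conj_by G g x))"
      using sub[of "inv g" "conj_by G g x"] g x w by auto
    then have "a (inv g) w \<in> supp x"
      using g x by (simp add: conj_by_conj_by)
    moreover have "w \<in> V"
      using w level_in_V by (auto simp: supp_def)
    ultimately show ?thesis
      using g by (metis act_act_inv imageI)
  qed
  with sub[OF g x] show ?thesis
    by blast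
qed

lemma fixed_or_below_level:
  assumes "z \<in> V"
  shows "(\<forall>h\<in>H. a h z = z) \<or> (\<exists>v\<in>L n. z \<in> T v)"
proof -
  obtain m where m: "z \<in> L m"
    using level_exists assms by blast
  show ?thesis
  proof (cases "n \<le> m")
    case True
    then have "z \<in> L (n + (m - n))"
      using m by simp
    then show ?thesis
      using tree_level_split[of z E r n "m - n"] unfolding mem_subtree_iff by blast
  next
    case False
    then have "a h z = z" if "h \<in> H" for h
      using fixes_upper_levels[OF H_carrier[OF that] fixes_level[OF that] _ m] by simp
    then show ?thesis by blast
  qed
qed

lemma H_subtree:
  assumes "h \<in> H" "v \<in> L n" "z \<in> T v"
  shows "a h z \<in> T v"
  using act_subtree[OF H_carrier[OF assms(1)] assms(3)] fixes_level assms by simp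

lemma disjoint_supp_commute:
  assumes x: "x \<in> H" and y: "y \<in> H" and disj: "supp x \<inter> supp y = {}"
  shows "x \<otimes> y = y \<otimes> x"
proof (rule eqI_act)
  have car: "x \<in> carrier G" "y \<in> carrier G"
    using x y H_carrier by auto
  fix z assume z: "z \<in> V"
  have "a x (a y z) = a y (a x z)"
  proof (cases "\<exists>v\<in>L n. z \<in> T v")
    case True
    then obtain v where v: "v \<in> L n" "z \<in> T v"
      by blast
    have "(\<forall>z\<in>T v. a x z = z) \<or> (\<forall>z\<in>T v. a y z = z)"
      using disj v(1) by (auto simp: supp_def)
    then show ?thesis
      using v(2) H_subtree[OF x v] H_subtree[OF y v] by auto
  next
    case False
    then have "a x z = z" "a y z = z"
      using fixed_or_below_level[OF z] x y by blast+
    then show ?thesis by simp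
  qed
  then show "a (x \<otimes> y) z = a (y \<otimes> x) z"
    using z car by (simp add: composition_rule)
qed (use x y H_carrier in auto)

text \<open>
  \<open>x\<close> and \<open>y\<close> may move vertices of different depth. Passing to descendants evens this out, because
  the descendants of a moved vertex are moved.
\<close>

lemma common_moved_vertex:
  assumes x: "x \<in> carrier G" and y: "y \<in> carrier G" and v: "v \<in> supp x" "v \<in> supp y"
  obtains u w k where "u \<in> tree_level E v k" "w \<in> tree_level E v k" "a x u \<noteq> u" "a y w \<noteq> w"
proof -
  have vL: "v \<in> L n" "v \<in> V"
    using v level_in_V by (auto simp: supp_def)
  obtain p q i j where p: "p \<in> tree_level E v i" "a x p \<noteq> p" and q: "q \<in> tree_level E v j" "a y q \<noteq> q"
    using v by (auto simp: supp_def mem_subtree_iff)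
  have V: "p \<in> V" "q \<in> V"
    using p q vL tree_level_in_V by blast+
  obtain u w where u: "u \<in> tree_level E p j" and w: "w \<in> tree_level E q i"
    using tree_level_nonempty V by meson
  have "a x u \<noteq> u" "a y w \<noteq> w"
    using moved_descendant[OF V(1) x p(2)] moved_descendant[OF V(2) y q(2)] u w
    by (auto simp: mem_subtree_iff)
  moreover have "u \<in> tree_level E v (i + j)" "w \<in> tree_level E v (i + j)"
    using tree_level_add[OF p(1) u] tree_level_add[OF q(1) w] by (simp_all add: add.commute)
  ultimately show ?thesis
    by (rule that[rotated 2])
qed

text \<open>
  If the supports meet, transitivity of \<open>H\<close> on levels makes it possible to replace \<open>y\<close> by an
  \<open>H\<close>-conjugate \<open>y'\<close> such that \<open>x\<close> and \<open>y'\<close> move the same vertex \<open>u\<close>. For \<open>g\<close> and \<open>k\<close> in \<open>H\<close> acting only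
  below \<open>u\<close>, the double commutator \<open>[k, [g, y']]\<close> equals \<open>[k, g]\<close>, since \<open>[g, y']\<close> is the product of \<open>g\<close>
  and an element acting only below \<open>y' u\<close>, which commutes with \<open>g\<close> and \<open>k\<close>. But the double commutator
  is a product of conjugates of \<open>y'\<close> and their inverses. So if \<open>x\<close> commutes with these conjugates, it
  commutes with \<open>[k, g]\<close>, which acts only below the moved vertex \<open>u\<close> and is therefore trivial. This
  contradicts the noncommutativity of the rigid stabilizer of \<open>u\<close> in \<open>H\<close>.
\<close>

lemma commutes_with_conjugates_iff:
  assumes x: "x \<in> H" and y: "y \<in> H"
  shows "commutes_with_conjugates G H x y \<longleftrightarrow> supp x \<inter> supp y = {}"
proof
  have car: "x \<in> carrier G" "y \<in> carrier G"
    using x y H_carrier by auto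
  assume disj: "supp x \<inter> supp y = {}"
  have "conj_by G x (conj_by G h y) = conj_by G h y" if h: "h \<in> H" for h
  proof -
    have "a h ` supp y = supp y"
      using fixes_level[OF h] by (force simp: supp_def)
    then have "supp x \<inter> supp (conj_by G h y) = {}"
      using disj supp_conj_by[OF H_carrier[OF h] car(2)] by simp
    then have "x \<otimes> conj_by G h y = conj_by G h y \<otimes> x"
      by (rule disjoint_supp_commute[OF x conj_closed[OF H_carrier[OF h] y]])
    then show ?thesis
      using car H_carrier[OF h] by (simp add: conj_by_eq_iff)
  qed
  then show "commutes_with_conjugates G H x y"
    by (simp add: commutes_with_conjugates_def)
next
  have car: "x \<in> carrier G" "y \<in> carrier G"
    using x y H_carrier by auto
  assume comm: "commutes_with_conjugates G H x y"
  \<comment> \<open>the centralizer of \<open>x\<close>; it contains the normal closure of \<open>y\<close> in \<open>H\<close>\<close>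
  define C where "C = {z \<in> carrier G. conj_by G x z = z}"
  have C_mult: "p \<otimes> q \<in> C" if "p \<in> C" "q \<in> C" for p q
    using that car by (simp add: C_def conj_by_mult)
  have C_inv: "inv p \<in> C" if "p \<in> C" for p
    using that car by (simp add: C_def conj_by_inv)
  have C_conj: "conj_by G h y \<in> C" if "h \<in> H" for h
    using comm that car H_carrier by (simp add: C_def commutes_with_conjugates_def)
  show "supp x \<inter> supp y = {}"
  proof (rule ccontr)
    assume "supp x \<inter> supp y \<noteq> {}"
    then obtain v where v: "v \<in> supp x" "v \<in> supp y"
      by blast
    then have vL: "v \<in> L n" "v \<in> V"
      using level_in_V by (auto simp: supp_def)
    obtain u u' l where u: "u \<in> tree_level E v l" "u' \<in> tree_level E v l" "a x u \<noteq> u" "a y u' \<noteq> u'"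
      using common_moved_vertex[OF car v] by blast
    obtain h where h: "h \<in> H" "a h u' = u"
      using H_transitive[OF vL(1) u(2,1)] by blast
    have uV: "u \<in> V" "u' \<in> V" "u \<in> T v"
      using u vL tree_level_in_V by (auto simp: mem_subtree_iff)
    define y' where "y' = conj_by G h y"
    have y': "y' \<in> carrier G"
      using h car H_carrier by (simp add: y'_def)
    have y'u: "a y' u \<noteq> u"
      using act_conj_by[OF H_carrier[OF h(1)] car(2) uV(2)] h(2) u(4)
        act_eq_iff[OF H_carrier[OF h(1)] act_in_V[OF car(2) uV(2)] uV(2)]
      by (simp add: y'_def)
    have C_conj': "conj_by G g y' \<in> C" if "g \<in> H" for g
      using C_conj[of "g \<otimes> h"] that h subgroup.m_closed[OF sub] H_carrier car
      by (simp add: y'_def conj_by_conj_by)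
    obtain g k where g: "g \<in> H" "g \<in> rist u" and k: "k \<in> H" "k \<in> rist u" and gk: "conj_by G k g \<noteq> g"
      using H_rist_nonabelian[OF vL(1) uV(3)] by blast
    have gc: "g \<in> carrier G" "k \<in> carrier G"
      using H_carrier[OF g(1)] H_carrier[OF k(1)] .
    define g' where "g' = conj_by G y' (inv g)"
    have g': "g' \<in> carrier G"
      using gc y' by (simp add: g'_def)
    have "g' \<in> rist (a y' u)"
      unfolding g'_def by (intro conj_by_rist rist_inv g y' uV)
    then have kg': "conj_by G k g' = g'"
      using disjoint_rist_commute[OF uV(1) act_in_V[OF y' uV(1)] moved_disjoint[OF uV(1) y' y'u] k(2)]
        gc g' by (simp add: conj_by_eq_iff)
    \<comment> \<open>\<open>z\<close> is the commutator \<open>[g, y']\<close>, and \<open>d\<close> below is \<open>[k, g] = [k, z]\<close>\<close>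
    define z where "z = g \<otimes> g'"
    have z_alt: "z = conj_by G g y' \<otimes> inv y'"
      using gc y' by (simp add: z_def g'_def conj_by_def m_assoc)
    have one: "\<one> \<in> H"
      by (rule subgroup.one_closed[OF sub])
    have zC: "z \<in> C"
      unfolding z_alt using C_conj'[OF g(1)] C_inv[OF C_conj'[OF one]] y' by (intro C_mult) auto
    have "conj_by G k z = conj_by G (k \<otimes> g) y' \<otimes> inv (conj_by G k y')"
      using gc y' by (simp add: z_alt conj_by_mult conj_by_inv conj_by_conj_by)
    then have "conj_by G k z \<in> C"
      using C_conj'[of "k \<otimes> g"] C_inv[OF C_conj'[OF k(1)]] g k subgroup.m_closed[OF sub]
      by (simp add: C_mult)
    then have dC: "conj_by G k z \<otimes> inv z \<in> C"
      using zC C_mult C_inv by blast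
    define d where "d = conj_by G k g \<otimes> inv g"
    have "g' \<otimes> (inv g' \<otimes> inv g) = inv g"
      using gc g' by (simp flip: m_assoc)
    then have "conj_by G k z \<otimes> inv z = d"
      using gc g' kg' by (simp add: z_def d_def conj_by_mult inv_mult_group m_assoc)
    with dC have "conj_by G x d = d"
      by (simp add: C_def)
    moreover have "conj_by G k g \<in> rist u"
      using g k unfolding conj_by_def by (intro rist_mult rist_inv)
    then have "d \<in> rist u"
      unfolding d_def using g by (intro rist_mult rist_inv)
    ultimately have "d = \<one>"
      using conj_by_moved_rist uV(1) car(1) u(3) by blast
    then show False
      using inv_solve_right[of \<one> "conj_by G k g" g] gk gc by (simp add: d_def)
  qed
qed

lemma iso_disjoint_supp:
  assumes "\<phi> \<in> iso G G" "\<phi> ` H = H" "x \<in> H" "y \<in> H"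
  shows "supp (\<phi> x) \<inter> supp (\<phi> y) = {} \<longleftrightarrow> supp x \<inter> supp y = {}"
  using iso_commutes_with_conjugates[OF assms(1,2) subgroup.subset[OF sub] assms(3,4)] assms(2-4)
    commutes_with_conjugates_iff[OF assms(3,4)] commutes_with_conjugates_iff[of "\<phi> x" "\<phi> y"]
  by blast

text \<open>
  If the support of \<open>\<phi>(x)\<close> contained two vertices, there would be elements with disjoint supports
  that both meet it. Their preimages would then have disjoint supports that both meet the single
  vertex supporting \<open>x\<close>.
\<close>

lemma iso_supp_singleton:
  assumes \<phi>: "\<phi> \<in> iso G G" "\<phi> ` H = H" and x: "x \<in> H" "supp x = {v}"
  shows "\<exists>w. supp (\<phi> x) = {w}"
proof -
  have "supp (\<phi> x) \<noteq> {}"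
    using iso_disjoint_supp[OF \<phi> x(1) x(1)] x(2) by simp
  moreover have "w1 = w2" if w: "w1 \<in> supp (\<phi> x)" "w2 \<in> supp (\<phi> x)" for w1 w2
  proof (rule ccontr)
    assume "w1 \<noteq> w2"
    have "w1 \<in> L n" "w2 \<in> L n"
      using w by (auto simp: supp_def)
    then obtain y1 y2 where "y1 \<in> \<phi> ` H" "supp y1 = {w1}" "y2 \<in> \<phi> ` H" "supp y2 = {w2}"
      using supp_singleton_exists \<phi>(2) by metis
    then obtain x1 x2 where x12: "x1 \<in> H" "supp (\<phi> x1) = {w1}" "x2 \<in> H" "supp (\<phi> x2) = {w2}"
      by blast
    have "v \<in> supp x1" "v \<in> supp x2"
      using iso_disjoint_supp[OF \<phi> x(1) x12(1)] iso_disjoint_supp[OF \<phi> x(1) x12(3)] x12 x(2) w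
      by auto
    then show False
      using iso_disjoint_supp[OF \<phi> x12(1,3)] x12 \<open>w1 \<noteq> w2\<close> by auto
  qed
  ultimately show ?thesis
    by blast
qed

text \<open>
  The value \<open>t v\<close> is the vertex that supports \<open>\<phi>(x)\<close> for any \<open>x\<close> supported at \<open>v\<close>. It does not depend
  on \<open>x\<close> because the images of two elements supported at \<open>v\<close> again have supports that meet.
  Equivariance follows since conjugating \<open>x\<close> by \<open>g\<close> moves its support by \<open>g\<close>.
\<close>

lemma iso_induced_on_level:
  assumes \<phi>: "\<phi> \<in> iso G G" "\<phi> ` H = H" and fin: "finite (L n)"
  obtains t where "bij_betw t (L n) (L n)"
    and "\<And>g v. g \<in> carrier G \<Longrightarrow> v \<in> L n \<Longrightarrow> t (a g v) = a (\<phi> g) (t v)"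
proof -
  have "\<exists>e. \<forall>v\<in>L n. e v \<in> H \<and> supp (e v) = {v}"
    using supp_singleton_exists by (intro bchoice) blast
  then obtain e where e: "\<And>v. v \<in> L n \<Longrightarrow> e v \<in> H" "\<And>v. v \<in> L n \<Longrightarrow> supp (e v) = {v}"
    by blast
  have "\<exists>t. \<forall>v\<in>L n. supp (\<phi> (e v)) = {t v}"
    using iso_supp_singleton[OF \<phi> e] by (intro bchoice) blast
  then obtain t where t: "\<And>v. v \<in> L n \<Longrightarrow> supp (\<phi> (e v)) = {t v}"
    by blast
  have t_unique: "supp (\<phi> x) = {t v}" if x: "x \<in> H" "supp x = {v}" "v \<in> L n" for x v
  proof -
    obtain w where w: "supp (\<phi> x) = {w}"
      using iso_supp_singleton[OF \<phi> x(1,2)] by blast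
    have "supp (\<phi> x) \<inter> supp (\<phi> (e v)) \<noteq> {}"
      using iso_disjoint_supp[OF \<phi> x(1) e(1)[OF x(3)]] e(2)[OF x(3)] x(2) by simp
    then show ?thesis
      using w t[OF x(3)] by auto
  qed
  have "t v \<in> L n" if "v \<in> L n" for v
    using t[OF that] by (auto simp: supp_def)
  then have "t ` L n \<subseteq> L n"
    by blast
  moreover have "inj_on t (L n)"
  proof (rule inj_onI)
    fix v w assume vw: "v \<in> L n" "w \<in> L n" "t v = t w"
    then have "supp (\<phi> (e v)) \<inter> supp (\<phi> (e w)) \<noteq> {}"
      using t by auto
    then show "v = w"
      using iso_disjoint_supp[OF \<phi> e(1)[OF vw(1)] e(1)[OF vw(2)]] e(2) vw(1,2) by auto
  qed
  ultimately have bij: "bij_betw t (L n) (L n)"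
    using fin endo_inj_surj unfolding bij_betw_def by blast
  have "t (a g v) = a (\<phi> g) (t v)" if g: "g \<in> carrier G" and v: "v \<in> L n" for g v
  proof -
    have ev: "e v \<in> carrier G" "\<phi> (e v) \<in> carrier G" "\<phi> g \<in> carrier G"
      using H_carrier e(1)[OF v] \<phi> g by (auto simp: iso_def hom_def)
    have "supp (conj_by G g (e v)) = {a g v}"
      using supp_conj_by[OF g ev(1)] e(2)[OF v] by simp
    then have "supp (\<phi> (conj_by G g (e v))) = {t (a g v)}"
      by (rule t_unique[OF conj_closed[OF g e(1)[OF v]] _ act_level[OF g v]])
    moreover have "supp (\<phi> (conj_by G g (e v))) = {a (\<phi> g) (t v)}"
      using supp_conj_by[OF ev(3,2)] t[OF v] iso_conj_by[OF \<phi>(1) g ev(1)] by simp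
    ultimately show ?thesis
      by simp
  qed
  with bij show ?thesis
    by (rule that)
qed

end


section \<open>Signs on the levels\<close>

lemma perm_restrict_permutes:
  assumes "bij_betw f S S"
  shows "perm_restrict f S permutes S"
  using assms bij_betw_cong[of S f "perm_restrict f S" S]
  by (intro bij_imp_permutes) (simp_all add: perm_restrict_simps)

lemma evenperm_perm_restrict_comp:
  assumes "finite S" "bij_betw f S S" "bij_betw g S S"
  shows "evenperm (perm_restrict (f \<circ> g) S) \<longleftrightarrow>
    evenperm (perm_restrict f S) = evenperm (perm_restrict g S)"
proof -
  have "perm_restrict (f \<circ> g) S = perm_restrict f S \<circ> perm_restrict g S"
    using bij_betwE[OF assms(3)] by (auto simp: perm_restrict_def fun_eq_iff)
  then show ?thesis
    using evenperm_comp permutes_imp_permutation[OF assms(1) perm_restrict_permutes] assms(2,3)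
    by metis
qed

text \<open>
  Comparing the parities of both sides of \<open>t \<circ> p = q \<circ> t\<close> lets that of \<open>t\<close> cancel.
\<close>

lemma evenperm_semiconjugate:
  assumes "finite S" "bij_betw t S S" "bij_betw p S S" "bij_betw q S S"
    and "\<And>x. x \<in> S \<Longrightarrow> t (p x) = q (t x)"
  shows "evenperm (perm_restrict q S) \<longleftrightarrow> evenperm (perm_restrict p S)"
proof -
  have "perm_restrict (t \<circ> p) S = perm_restrict (q \<circ> t) S"
    using assms(5) by (auto simp: perm_restrict_def fun_eq_iff)
  then show ?thesis
    using evenperm_perm_restrict_comp[OF assms(1,2,3)] evenperm_perm_restrict_comp[OF assms(1,4,2)]
    by auto
qed

context weakly_branch_action
begin

lemma act_bij_level: "g \<in> carrier G \<Longrightarrow> bij_betw (a g) (L n) (L n)"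
  by (rule bij_betw_byWitness[where f' = "a (inv g)"]) (auto simp: act_level level_in_V)

lemma odd_on_level_mult:
  assumes "finite (L n)" "g \<in> carrier G" "h \<in> carrier G"
  shows "odd_on_level r E a (g \<otimes> h) n \<longleftrightarrow> odd_on_level r E a g n \<noteq> odd_on_level r E a h n"
proof -
  have "perm_restrict (a (g \<otimes> h)) (L n) = perm_restrict (a g \<circ> a h) (L n)"
    using assms level_in_V by (auto simp: perm_restrict_def composition_rule fun_eq_iff)
  then show ?thesis
    using evenperm_perm_restrict_comp[OF assms(1) act_bij_level[OF assms(2)] act_bij_level[OF assms(3)]]
    by (auto simp: odd_on_level_def)
qed

lemma odd_on_level_inv:
  assumes "finite (L n)" "g \<in> carrier G"
  shows "odd_on_level r E a (inv g) n \<longleftrightarrow> odd_on_level r E a g n"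
proof -
  have "odd_on_level r E a (\<one> \<otimes> \<one>) n \<longleftrightarrow> False"
    using odd_on_level_mult[OF assms(1), of \<one> \<one>] by simp
  then show ?thesis
    using odd_on_level_mult[OF assms(1), of g "inv g"] assms(2) by simp
qed

lemma not_odd_on_stabilized_level:
  assumes "g \<in> level_stabilizer G r E a j" "m \<le> j"
  shows "\<not> odd_on_level r E a g m"
proof -
  have "a g v = v" if "v \<in> L m" for v
    by (rule fixes_upper_levels[OF _ _ assms(2) that]) (use assms(1) in \<open>auto simp: level_stabilizer_def\<close>)
  then have "perm_restrict (a g) (L m) = id"
    by (auto simp: perm_restrict_def fun_eq_iff)
  then show ?thesis
    by (simp add: odd_on_level_def)
qed

lemma saturating_subgroup_of_saturated:
  assumes "saturated r E G a" "n \<ge> 1"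
  obtains H where "characteristic_subgroup H G" "saturating_subgroup V r E G a n H"
proof -
  obtain H where H: "characteristic_subgroup H G" "\<forall>h\<in>H. \<forall>v\<in>L n. a h v = v"
      "\<forall>v\<in>L n. level_transitive_on_subtree E a H v"
    using assms unfolding saturated_def by blast
  have "saturating_subgroup V r E G a n H"
  proof (intro saturating_subgroup.intro saturating_subgroup_axioms.intro)
    show "weakly_branch_action V r E G a" ..
    show "subgroup H G"
      using H(1) by (simp add: characteristic_subgroup_def)
    show "conj_by G g h \<in> H" if "g \<in> carrier G" "h \<in> H" for g h
      using H(1) conj_by_iso[OF that(1)] that(2) unfolding characteristic_subgroup_def by blast
  qed (use H in auto)
  with H(1) show ?thesis
    by (rule that)
qed

lemma odd_on_level_iso:
  assumes "saturated r E G a" "n \<ge> 1" "finite (L n)" "\<phi> \<in> iso G G" "g \<in> carrier G"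
  shows "odd_on_level r E a (\<phi> g) n \<longleftrightarrow> odd_on_level r E a g n"
proof -
  obtain H where H: "characteristic_subgroup H G" "saturating_subgroup V r E G a n H"
    using saturating_subgroup_of_saturated assms by blast
  have "\<phi> ` H = H"
    using H(1) assms(4) by (simp add: characteristic_subgroup_def)
  then obtain t where t: "bij_betw t (L n) (L n)"
      "\<And>g v. g \<in> carrier G \<Longrightarrow> v \<in> L n \<Longrightarrow> t (a g v) = a (\<phi> g) (t v)"
    using saturating_subgroup.iso_induced_on_level[OF H(2) assms(4) _ assms(3)] by blast
  have "\<phi> g \<in> carrier G"
    using assms(4,5) by (auto simp: iso_def hom_def)
  then show ?thesis
    using evenperm_semiconjugate[OF assms(3) t(1) act_bij_level[OF assms(5)] act_bij_level t(2)[OF assms(5)]]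
    by (simp add: odd_on_level_def)
qed

text \<open>
  The signs of \<open>h\<close> and of \<open>\<phi>(h\<^sup>-\<^sup>1)\<close> agree and cancel.
\<close>

lemma odd_on_level_twisted_conjugate:
  assumes "saturated r E G a" "n \<ge> 1" "finite (L n)" "\<phi> \<in> iso G G"
    and "(x, y) \<in> twisted_conjugacy G \<phi>"
  shows "odd_on_level r E a x n \<longleftrightarrow> odd_on_level r E a y n"
proof -
  obtain h where h: "h \<in> carrier G" "x \<in> carrier G" "y = h \<otimes> x \<otimes> \<phi> (inv h)"
    using assms(5) by (auto simp: twisted_conjugacy_def)
  have "\<phi> (inv h) \<in> carrier G"
    using assms(4) h(1) by (auto simp: iso_def hom_def)
  then show ?thesis
    using odd_on_level_mult[OF assms(3)] odd_on_level_iso[OF assms(1-4), of "inv h"]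
      odd_on_level_inv[OF assms(3) h(1)] h by auto
qed

end

lemma infinite_quotient_if_unbounded_invariant:
  fixes f :: "'a \<Rightarrow> nat"
  assumes "equiv A R" and inv: "\<And>x y. (x, y) \<in> R \<Longrightarrow> f x = f y" and unb: "\<And>j. \<exists>x\<in>A. f x > j"
  shows "infinite (A // R)"
proof
  assume fin: "finite (A // R)"
  have "f ` A \<subseteq> (\<lambda>X. f (SOME x. x \<in> X)) ` (A // R)"
  proof
    fix m assume "m \<in> f ` A"
    then obtain x where x: "x \<in> A" "m = f x"
      by blast
    have "(SOME y. y \<in> R `` {x}) \<in> R `` {x}"
      by (rule someI[of "\<lambda>y. y \<in> R `` {x}"]) (rule equiv_class_self[OF assms(1) x(1)])
    then have "m = f (SOME y. y \<in> R `` {x})"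
      using inv x by blast
    then show "m \<in> (\<lambda>X. f (SOME x. x \<in> X)) ` (A // R)"
      using quotientI[OF x(1)] by blast
  qed
  then have "finite (f ` A)"
    using fin finite_surj by blast
  then obtain j where "\<forall>m\<in>f ` A. m \<le> j"
    using finite_nat_set_iff_bounded_le by blast
  then show False
    using unb[of j] by force
qed

theorem theorem5p2:
  fixes V :: "'v set" and r :: 'v and E :: "('v \<times> 'v) set"
    and G :: "('g, 'm) monoid_scheme" and a :: "'g \<Rightarrow> 'v \<Rightarrow> 'v"
  assumes "spherically_symmetric_tree V r E"
    and "weakly_branch V r E G a"
    and "saturated r E G a"
    and "\<forall>j. \<exists>g\<in>level_stabilizer G r E a j. \<exists>j\<^sub>0>j. odd_on_level r E a g j\<^sub>0"
  shows "R_infinity_group G"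
proof -
  interpret weakly_branch_action V r E G a
    using assms(2)
    by (auto simp: weakly_branch_def weakly_branch_action_def weakly_branch_action_axioms_def)
  have fin: "finite (L n)" for n
    by (rule spherically_symmetric_tree.finite_level[OF assms(1)])
  have "reidemeister_number G \<phi> = \<infinity>" if \<phi>: "\<phi> \<in> iso G G" for \<phi>
  proof -
    \<comment> \<open>The first level on which \<open>x\<close> is odd. All elements that are even on every level share the value
      \<open>Inf {}\<close>, so \<open>f\<close> depends only on the set of odd levels.\<close>
    define f where "f x = Inf {n. n \<ge> 1 \<and> odd_on_level r E a x n}" for x
    have "infinite (carrier G // twisted_conjugacy G \<phi>)"
    proof (rule infinite_quotient_if_unbounded_invariant)
      show "equiv (carrier G) (twisted_conjugacy G \<phi>)"
        by (rule equiv_twisted_conjugacy[OF is_group \<phi>])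
      show "f x = f y" if "(x, y) \<in> twisted_conjugacy G \<phi>" for x y
        unfolding f_def
        using odd_on_level_twisted_conjugate[OF assms(3) _ fin \<phi> that] by (intro arg_cong[of _ _ Inf]) auto
      show "\<exists>x\<in>carrier G. f x > j" for j
      proof -
        obtain g j0 where g: "g \<in> level_stabilizer G r E a j" "j0 > j" "odd_on_level r E a g j0"
          using assms(4) by blast
        then have "{n. n \<ge> 1 \<and> odd_on_level r E a g n} \<noteq> {}"
          by (auto intro!: exI[of _ j0])
        then have "f g \<in> {n. n \<ge> 1 \<and> odd_on_level r E a g n}"
          unfolding f_def by (rule Inf_nat_def1)
        then have "f g > j"
          using not_odd_on_stabilized_level[OF g(1), of "f g"] by (cases "f g \<le> j") auto
        moreover have "g \<in> carrier G"
          using g(1) by (simp add: level_stabilizer_def)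
        ultimately show ?thesis
          by blast
      qed
    qed
    then show ?thesis
      by (simp add: reidemeister_number_def)
  qed
  then show ?thesis
    using is_group by (simp add: R_infinity_group_def)
qed

end
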